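(* Let $n \ge 1$, $\alpha = (\alpha_1,\dots,\alpha_n), \beta = (\beta_1,\dots,\beta_n) \in \mathbb{C}^n$, and let $h_\alpha$, $h_\beta$ be holizations of $A(\alpha)$ and $A(\beta)$ respectively, with $V(\alpha) = h_\alpha(\mathbb{D})$, $V(\beta) = h_\beta(\mathbb{D})$. Then there is a biholomorphic homeomorphism from $V(\alpha)$ onto $V(\beta)$ if and only if there is a constant $\tau \in \mathbb{C}$ with $|\tau| = 1$ such that $\beta_j = \tau^{2j-1}\alpha_j$ for all $1 \le j \le n$.
   Context: $\mathbb{D}$ is the open unit disk, $O(\mathbb{D})$ the holomorphic functions on it. For $\alpha \in \mathbb{C}^n$, let $\pi_\alpha(z) = z^2 + \alpha_1 z^3 + \alpha_2 z^5 + \dots + \alpha_n z^{2n+1}$ and let $A(\alpha) = \{ p\circ\pi_\alpha + z^{2n+2} g : p \text{ a polynomial of degree} \le n,\ g \in O(\mathbb{D})\}$, the simple cusp subalgebra of $O(\mathbb{D})$ of codimension $n+1$ with primitive $\pi_\alpha$. A holomap is a proper holomorphic map $h : \mathbb{D} \to \Omega$ into an open set $\Omega \subsetneq \mathbb{C}^N$ which is one-to-one and non-singular except on a finite set. For $V = h(\mathbb{D})$, $O(V)$ is the algebra of functions on $V$ which near each point $P \in V$ agree with the restriction of a function holomorphic in a neighborhood of $P$ in $\mathbb{C}^N$, and $A_h = \{F\circ h : F \in O(V)\}$. A holomap $h$ holizes (is a holization of) a subalgebra $A \subseteq O(\mathbb{D})$ if $A = A_h$. A biholomorphic homeomorphism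 $\phi : V_1 \to V_2$ is a homeomorphism such that the coordinates of $\phi$ lie in $O(V_1)$ and those of $\phi^{-1}$ lie in $O(V_2)$. *)

theory Defs
  imports "HOL-Analysis.Analysis"
begin

definition unit_disk :: "complex set" where
  "unit_disk = ball 0 1"

definition cusp_prim :: "nat \<Rightarrow> (nat \<Rightarrow> complex) \<Rightarrow> complex \<Rightarrow> complex" where
  "cusp_prim n \<alpha> z = z ^ 2 + (\<Sum>j=1..n. \<alpha> j * z ^ (2 * j + 1))"

text \<open>The simple cusp subalgebra A(alpha) of O(D); functions are identified when they
  agree on the disk (membership only depends on the restriction to D).\<close>
definition cusp_alg :: "nat \<Rightarrow> (nat \<Rightarrow> complex) \<Rightarrow> (complex \<Rightarrow> complex) set" where
  "cusp_alg n \<alpha> = {f. \<exists>(p::complex poly) g. degree p \<le> n \<and> g holomorphic_on unit_disk \<and>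
      (\<forall>z\<in>unit_disk. f z = poly p (cusp_prim n \<alpha> z) + z ^ (2 * n + 2) * g z)}"

definition cholo_on :: "(complex ^ 'n) set \<Rightarrow> (complex ^ 'n \<Rightarrow> complex) \<Rightarrow> bool" where
  "cholo_on U G \<longleftrightarrow> open U \<and>
     (\<forall>x\<in>U. \<exists>L. (G has_derivative L) (at x) \<and> (\<forall>c v. L (c *s v) = c * L v))"

definition O_var :: "(complex ^ 'n) set \<Rightarrow> (complex ^ 'n \<Rightarrow> complex) set" where
  "O_var V = {F. \<forall>P\<in>V. \<exists>U G. P \<in> U \<and> cholo_on U G \<and> (\<forall>Q\<in>V \<inter> U. F Q = G Q)}"

definition holomap :: "(complex \<Rightarrow> complex ^ 'n) \<Rightarrow> (complex ^ 'n) set \<Rightarrow> bool" where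
  "holomap h \<Omega> \<longleftrightarrow> open \<Omega> \<and> \<Omega> \<noteq> UNIV \<and> h ` unit_disk \<subseteq> \<Omega> \<and>
     (\<forall>i. (\<lambda>z. h z $ i) holomorphic_on unit_disk) \<and>
     (\<forall>K. compact K \<and> K \<subseteq> \<Omega> \<longrightarrow> compact (unit_disk \<inter> h -` K)) \<and>
     (\<exists>E. finite E \<and> E \<subseteq> unit_disk \<and> inj_on h (unit_disk - E) \<and>
        (\<forall>z\<in>unit_disk - E. \<exists>i. deriv (\<lambda>w. h w $ i) z \<noteq> 0))"

text \<open>A_h = {F o h : F in O(V)}, V = h(D) (functions identified on D).\<close>
definition A_of :: "(complex \<Rightarrow> complex ^ 'n) \<Rightarrow> (complex \<Rightarrow> complex) set" where
  "A_of h = {f. \<exists>F\<in>O_var (h ` unit_disk). \<forall>z\<in>unit_disk. f z = F (h z)}"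

definition holizes :: "(complex \<Rightarrow> complex ^ 'n) \<Rightarrow> (complex \<Rightarrow> complex) set \<Rightarrow> bool" where
  "holizes h A \<longleftrightarrow> (\<exists>\<Omega>. holomap h \<Omega>) \<and> A_of h = A"

definition bihol_homeo ::
  "(complex ^ 'n) set \<Rightarrow> (complex ^ 'm) set \<Rightarrow> (complex ^ 'n \<Rightarrow> complex ^ 'm) \<Rightarrow> (complex ^ 'm \<Rightarrow> complex ^ 'n) \<Rightarrow> bool" where
  "bihol_homeo V1 V2 \<phi> \<psi> \<longleftrightarrow> homeomorphism V1 V2 \<phi> \<psi> \<and>
     (\<forall>j. (\<lambda>x. \<phi> x $ j) \<in> O_var V1) \<and> (\<forall>j. (\<lambda>y. \<psi> y $ j) \<in> O_var V2)"

end

theory Submission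
  imports Defs "HOL-Complex_Analysis.Conformal_Mappings"
begin

text \<open>The powers \<open>z ^ (2n + 2)\<close> and \<open>z ^ (2n + 3)\<close> lie in every cusp algebra and separate points,
  so the holizations are injective and a biholomorphic homeomorphism lifts to a bijection \<open>\<sigma>\<close> of
  the disk that pulls \<open>A(\<beta>)\<close> back into \<open>A(\<alpha>)\<close>. It is holomorphic, being a quotient of the pullbacks
  of the two powers, and fixes \<open>0\<close>, the only point at which all derivatives of functions of the
  algebra vanish; by the Schwarz lemma it is a rotation \<open>z \<mapsto> c z\<close>. Comparing coefficients in
  \<open>\<pi>\<^sub>\<beta>(c z) = p(\<pi>\<^sub>\<alpha>(z))\<close> modulo \<open>z ^ (2n + 2)\<close> forces \<open>p = c\<^sup>2 X\<close>, which gives the relation with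
  \<open>\<tau> = 1 / c\<close>. Conversely, \<open>\<pi>\<^sub>\<alpha>(\<tau> z) = \<tau>\<^sup>2 \<pi>\<^sub>\<beta>(z)\<close>, so rotation identifies the two algebras.\<close>

section \<open>Functions on a variety\<close>

lemma has_derivative_vec_lambda:
  fixes f :: "'a::real_normed_vector \<Rightarrow> 'i::finite \<Rightarrow> 'b::euclidean_space"
  assumes "\<And>j. ((\<lambda>x. f x j) has_derivative L j) (at x within S)"
  shows "((\<lambda>x. \<chi> j. f x j) has_derivative (\<lambda>v. \<chi> j. L j v)) (at x within S)"
proof -
  have "((\<lambda>x. f x j \<bullet> b) has_derivative (\<lambda>v. L j v \<bullet> b)) (at x within S)" for j b
    using has_derivative_inner_left[OF assms] .
  then show ?thesis
    by (subst has_derivative_componentwise_within) (auto simp: Basis_vec_def inner_axis)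
qed

lemma cholo_on_subset:
  assumes "cholo_on U G" "open W" "W \<subseteq> U"
  shows "cholo_on W G"
  using assms unfolding cholo_on_def by blast

lemma cholo_on_imp_continuous_on:
  assumes "cholo_on U G"
  shows "continuous_on U G"
  using assms unfolding cholo_on_def
  by (meson continuous_at_imp_continuous_on has_derivative_continuous)

text \<open>The chain rule, stated for separate components because the local extensions of a map
  between varieties come one coordinate at a time. Complex homogeneity passes from all
  \<open>L j\<close> and \<open>M\<close> to the composed derivative.\<close>

lemma cholo_on_compose:
  fixes G :: "complex ^ 'm \<Rightarrow> complex" and H :: "complex ^ 'n \<Rightarrow> 'm \<Rightarrow> complex"
  assumes G: "cholo_on U G" and H: "\<And>j. cholo_on W (\<lambda>x. H x j)"
    and sub: "\<And>x. x \<in> W \<Longrightarrow> (\<chi> j. H x j) \<in> U"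
  shows "cholo_on W (\<lambda>x. G (\<chi> j. H x j))"
  unfolding cholo_on_def
proof (intro conjI ballI)
  show "open W" using H unfolding cholo_on_def by blast
  fix x assume x: "x \<in> W"
  have "\<forall>j. \<exists>L. ((\<lambda>x. H x j) has_derivative L) (at x) \<and> (\<forall>c v. L (c *s v) = c * L v)"
    using H x unfolding cholo_on_def by blast
  then obtain L where L: "\<And>j. ((\<lambda>x. H x j) has_derivative L j) (at x)"
    and Ls: "\<And>j c v. L j (c *s v) = c * L j v"
    by metis
  obtain M where M: "(G has_derivative M) (at (\<chi> j. H x j))"
    and Ms: "\<And>c v. M (c *s v) = c * M v"
    using G sub[OF x] unfolding cholo_on_def by blast
  have "((\<lambda>x. G (\<chi> j. H x j)) has_derivative (\<lambda>v. M (\<chi> j. L j v))) (at x)"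
    by (rule has_derivative_compose[OF has_derivative_vec_lambda[OF L] M])
  moreover have "M (\<chi> j. L j (c *s v)) = c * M (\<chi> j. L j v)" for c v
  proof -
    have "(\<chi> j. L j (c *s v)) = c *s (\<chi> j. L j v)"
      by (simp add: Ls vec_eq_iff)
    then show ?thesis by (simp add: Ms)
  qed
  ultimately show "\<exists>L. ((\<lambda>x. G (\<chi> j. H x j)) has_derivative L) (at x) \<and>
      (\<forall>c v. L (c *s v) = c * L v)"
    by blast
qed

lemma O_var_cong:
  assumes "F \<in> O_var V" "\<And>x. x \<in> V \<Longrightarrow> F' x = F x"
  shows "F' \<in> O_var V"
  using assms unfolding O_var_def by simp

lemma O_var_coord: "(\<lambda>x::complex^'n. x $ i) \<in> O_var V"
proof -
  have "cholo_on UNIV (\<lambda>x::complex^'n. x $ i)"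
    unfolding cholo_on_def
    by (auto intro!: exI[of _ "\<lambda>x. x $ i"] bounded_linear_imp_has_derivative bounded_linear_vec_nth)
  then show ?thesis
    unfolding O_var_def by blast
qed

lemma O_var_imp_continuous_on:
  assumes "F \<in> O_var V"
  shows "continuous_on V F"
  unfolding continuous_on_eq_continuous_within
proof
  fix P assume P: "P \<in> V"
  obtain U G where U: "P \<in> U" and G: "cholo_on U G" and eq: "\<forall>Q\<in>V \<inter> U. F Q = G Q"
    using assms P unfolding O_var_def by blast
  have "open U" using G unfolding cholo_on_def by blast
  have "continuous (at P) G"
    using cholo_on_imp_continuous_on[OF G] U \<open>open U\<close> continuous_on_eq_continuous_at by blast
  then have "continuous (at P within V) G"
    by (rule continuous_at_imp_continuous_within)
  then show "continuous (at P within V) F"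
    by (rule continuous_transform_within_openin[of _ _ _ "V \<inter> U"])
      (use U P eq \<open>open U\<close> in \<open>auto simp: openin_open_Int\<close>)
qed

text \<open>The extensions of the finitely many coordinates of \<open>\<phi>\<close> live on
  different neighbourhoods of \<open>P\<close>. These are intersected to \<open>Z\<close> and then
  shrunk to \<open>Z'\<close>, where the tuple \<open>K\<close> of extensions stays inside the
  domain of the extension of \<open>F\<close>.\<close>

lemma O_var_compose:
  fixes \<phi> :: "complex ^ 'n \<Rightarrow> complex ^ 'm"
  assumes F: "F \<in> O_var W" and \<phi>: "\<And>j. (\<lambda>x. \<phi> x $ j) \<in> O_var V" and sub: "\<phi> ` V \<subseteq> W"
  shows "(\<lambda>x. F (\<phi> x)) \<in> O_var V"
  unfolding O_var_def
proof (clarify)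
  fix P assume P: "P \<in> V"
  obtain U G where U: "\<phi> P \<in> U" and G: "cholo_on U G" and eqG: "\<forall>Q\<in>W \<inter> U. F Q = G Q"
    using F P sub unfolding O_var_def by blast
  have "\<forall>j. \<exists>Y H. P \<in> Y \<and> cholo_on Y H \<and> (\<forall>Q\<in>V \<inter> Y. \<phi> Q $ j = H Q)"
    using \<phi> P unfolding O_var_def by blast
  then obtain Y H where Y: "\<And>j. P \<in> Y j" and H: "\<And>j. cholo_on (Y j) (H j)"
    and eqH: "\<And>j Q. Q \<in> V \<Longrightarrow> Q \<in> Y j \<Longrightarrow> \<phi> Q $ j = H j Q"
    by (metis IntI)
  define Z where "Z = (\<Inter>j. Y j)"
  have "open (Y j)" for j using H unfolding cholo_on_def by blast
  then have oZ: "open Z" unfolding Z_def by (intro open_INT) auto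
  have HZ: "cholo_on Z (H j)" for j
    by (rule cholo_on_subset[OF H oZ]) (auto simp: Z_def)
  define K where "K x = (\<chi> j. H j x)" for x
  have cK: "continuous_on Z K"
    unfolding K_def by (intro continuous_on_vec_lambda cholo_on_imp_continuous_on HZ)
  have oU: "open U" using G unfolding cholo_on_def by blast
  define Z' where "Z' = Z \<inter> K -` U"
  have oZ': "open Z'"
    unfolding Z'_def by (rule continuous_open_preimage[OF cK oZ oU])
  have eqK: "\<phi> Q = K Q" if "Q \<in> V" "Q \<in> Z" for Q
    using that eqH by (auto simp: K_def vec_eq_iff Z_def)
  have "cholo_on Z' (\<lambda>x. G (K x))"
    unfolding K_def
  proof (rule cholo_on_compose[OF G])
    show "cholo_on Z' (H j)" for j
      by (rule cholo_on_subset[OF HZ oZ']) (auto simp: Z'_def)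
  qed (auto simp: Z'_def K_def)
  moreover have "P \<in> Z'"
    using Y P U eqK[of P] by (auto simp: Z'_def Z_def)
  moreover have "\<forall>Q\<in>V \<inter> Z'. F (\<phi> Q) = G (K Q)"
    using eqK eqG sub by (force simp: Z'_def)
  ultimately show "\<exists>U G. P \<in> U \<and> cholo_on U G \<and> (\<forall>Q\<in>V \<inter> U. F (\<phi> Q) = G Q)"
    by blast
qed

text \<open>When \<open>\<sigma>\<close> lifts \<open>\<phi>\<close> to the disk,
  \<open>f = F o k\<close> gives \<open>f o \<sigma> = (F o \<phi>) o h\<close>. Lifts thus act
  contravariantly on the algebras.\<close>

lemma A_of_pullback:
  fixes \<phi> :: "complex ^ 'n \<Rightarrow> complex ^ 'm"
  assumes \<phi>: "\<And>j. (\<lambda>x. \<phi> x $ j) \<in> O_var (h ` unit_disk)"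
    and \<sigma>: "\<And>z. z \<in> unit_disk \<Longrightarrow> \<sigma> z \<in> unit_disk \<and> k (\<sigma> z) = \<phi> (h z)"
    and f: "f \<in> A_of k"
  shows "(\<lambda>z. f (\<sigma> z)) \<in> A_of h"
proof -
  obtain F where F: "F \<in> O_var (k ` unit_disk)" and fF: "\<And>z. z \<in> unit_disk \<Longrightarrow> f z = F (k z)"
    using f unfolding A_of_def by blast
  have "\<phi> ` h ` unit_disk \<subseteq> k ` unit_disk"
  proof clarify
    fix z assume "z \<in> unit_disk"
    then show "\<phi> (h z) \<in> k ` unit_disk" using \<sigma>[of z] by (metis imageI)
  qed
  then have "(\<lambda>x. F (\<phi> x)) \<in> O_var (h ` unit_disk)"
    by (rule O_var_compose[OF F \<phi>])
  then show ?thesis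
    unfolding A_of_def using \<sigma> fF by (auto intro!: bexI[of _ "\<lambda>x. F (\<phi> x)"])
qed

section \<open>The cusp algebra\<close>

lemma cusp_alg_holomorphic:
  assumes "f \<in> cusp_alg n \<alpha>"
  shows "f holomorphic_on unit_disk"
proof -
  obtain p g where "g holomorphic_on unit_disk"
    and *: "\<And>z. z \<in> unit_disk \<Longrightarrow> f z = poly p (cusp_prim n \<alpha> z) + z ^ (2 * n + 2) * g z"
    using assms unfolding cusp_alg_def by blast
  then have "(\<lambda>z. poly p (cusp_prim n \<alpha> z) + z ^ (2 * n + 2) * g z) holomorphic_on unit_disk"
    unfolding cusp_prim_def poly_altdef by (intro holomorphic_intros)
  then show ?thesis
    using * by (metis (no_types, lifting) holomorphic_transform)
qed

text \<open>Both \<open>cusp_prim n \<alpha>\<close> and \<open>z ^ (2 * n + 2)\<close> vanish to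
  order at least two at 0.\<close>

lemma cusp_alg_deriv_0:
  assumes "f \<in> cusp_alg n \<alpha>"
  shows "deriv f 0 = 0"
proof -
  obtain p g where g: "g holomorphic_on unit_disk"
    and *: "\<And>z. z \<in> unit_disk \<Longrightarrow> f z = poly p (cusp_prim n \<alpha> z) + z ^ (2 * n + 2) * g z"
    using assms unfolding cusp_alg_def by blast
  have "(g has_field_derivative deriv g 0) (at 0)"
    using g by (auto simp: unit_disk_def intro!: holomorphic_derivI[of _ "ball 0 1"])
  moreover have "(cusp_prim n \<alpha> has_field_derivative 0) (at 0)"
    unfolding cusp_prim_def by (auto intro!: derivative_eq_intros sum.neutral)
  ultimately have "((\<lambda>z. poly p (cusp_prim n \<alpha> z) + z ^ (2 * n + 2) * g z)
      has_field_derivative 0) (at 0)"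
    by (auto intro!: derivative_eq_intros DERIV_chain2[OF poly_DERIV])
  then have "(f has_field_derivative 0) (at 0)"
    by (rule has_field_derivative_transform_within_open[of _ _ _ "ball 0 1"])
      (use * in \<open>auto simp: unit_disk_def\<close>)
  then show ?thesis by (rule DERIV_imp_deriv)
qed

lemma power_in_cusp_alg:
  assumes "m \<ge> 2 * n + 2"
  shows "(\<lambda>z. z ^ m) \<in> cusp_alg n \<alpha>"
proof -
  have "z ^ m = z ^ (2 * n + 2) * z ^ (m - (2 * n + 2))" for z :: complex
    using assms by (metis le_add_diff_inverse power_add)
  then show ?thesis
    unfolding cusp_alg_def
    by (auto intro!: exI[of _ 0] exI[of _ "\<lambda>z. z ^ (m - (2 * n + 2))"] holomorphic_intros)
qed

lemma cusp_prim_in_cusp_alg: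
  assumes "n \<ge> 1"
  shows "cusp_prim n \<alpha> \<in> cusp_alg n \<alpha>"
  unfolding cusp_alg_def using assms
  \<comment> \<open>The witness is \<open>p = X\<close>, whose degree 1 is admissible since
    \<open>n \<ge> 1\<close>.\<close>
  by (auto intro!: exI[of _ "[:0, 1:]"] exI[of _ "\<lambda>_. 0"])

lemma cusp_alg_rotate:
  assumes \<tau>: "norm \<tau> = 1" and \<beta>: "\<forall>j\<in>{1..n}. \<beta> j = \<tau> ^ (2 * j - 1) * \<alpha> j"
    and f: "f \<in> cusp_alg n \<alpha>"
  shows "(\<lambda>z. f (\<tau> * z)) \<in> cusp_alg n \<beta>"
proof -
  obtain p g where p: "degree p \<le> n" and g: "g holomorphic_on unit_disk"
    and *: "\<And>z. z \<in> unit_disk \<Longrightarrow> f z = poly p (cusp_prim n \<alpha> z) + z ^ (2 * n + 2) * g z"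
    using f unfolding cusp_alg_def by blast
  have D: "\<tau> * z \<in> unit_disk" if "z \<in> unit_disk" for z
    using that \<tau> by (simp add: unit_disk_def norm_mult)
  have pw: "(\<tau> * z) ^ (2 * j + 1) = \<tau>\<^sup>2 * \<tau> ^ (2 * j - 1) * z ^ (2 * j + 1)" if "j \<in> {1..n}" for j z
  proof -
    have "2 * j + 1 = 2 + (2 * j - 1)" using that by auto
    then show ?thesis by (metis power_add power_mult_distrib)
  qed
  have prim: "cusp_prim n \<alpha> (\<tau> * z) = \<tau>\<^sup>2 * cusp_prim n \<beta> z" for z
    unfolding cusp_prim_def distrib_left sum_distrib_left power_mult_distrib[of _ _ 2]
    by (intro arg_cong2[of _ _ _ _ "(+)"] sum.cong refl, subst pw) (use \<beta> in auto)
  \<comment> \<open>The factor \<open>\<tau>\<^sup>2\<close> from \<open>prim\<close> is absorbed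
    into the polynomial as p(\<open>\<tau>\<^sup>2\<close> X), and that of the remainder into
    \<open>g\<close>.\<close>
  let ?q = "pcompose p [:0, \<tau>\<^sup>2:]" and ?g = "\<lambda>z. \<tau> ^ (2 * n + 2) * g (\<tau> * z)"
  have "degree ?q \<le> n"
    using p degree_pcompose_le[of p "[:0, \<tau>\<^sup>2:]"] by (auto split: if_splits)
  moreover have "?g holomorphic_on unit_disk"
    using holomorphic_on_compose_gen[OF _ g, of "\<lambda>z. \<tau> * z" unit_disk] D
    by (auto intro!: holomorphic_intros simp: o_def)
  moreover have "f (\<tau> * z) = poly ?q (cusp_prim n \<beta> z) + z ^ (2 * n + 2) * ?g z"
    if "z \<in> unit_disk" for z
    using *[OF D[OF that]] by (simp add: prim poly_pcompose power_mult_distrib mult_ac)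
  ultimately show ?thesis unfolding cusp_alg_def by blast
qed

section \<open>Comparison of coefficients modulo a power of z\<close>

lemma poly_eq_power_mult_imp_monom_dvd:
  fixes P :: "complex poly"
  assumes g: "isCont g 0" and r: "r > 0"
    and eq: "\<And>z. z \<in> ball 0 r \<Longrightarrow> poly P z = z ^ m * g z"
  shows "monom 1 m dvd P"
proof (rule ccontr)
  assume ndvd: "\<not> monom 1 m dvd P"
  then have P: "P \<noteq> 0" by auto
  define k where "k = order 0 P"
  have km: "k < m" using ndvd monom_1_dvd_iff[OF P, of m] by (simp add: k_def)
  obtain Q where Q: "P = [:0, 1:] ^ k * Q" and nQ: "\<not> [:0, 1:] dvd Q"
    using order_decomp[OF P, of 0] by (auto simp: k_def)
  have "poly Q 0 \<noteq> 0" using nQ by (simp add: dvd_iff_poly_eq_0)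
  \<comment> \<open>After division by \<open>z ^ k\<close> the two sides have different limits at 0:
    \<open>poly Q 0 \<noteq> 0\<close> on the left, and 0 on the right because
    \<open>m - k > 0\<close>.\<close>
  have "poly Q z = z ^ (m - k) * g z" if "z \<in> ball 0 r" "z \<noteq> 0" for z
  proof -
    have "z ^ k * poly Q z = z ^ k * (z ^ (m - k) * g z)"
      using eq[OF that(1)] km by (simp add: Q flip: power_add mult.assoc)
    then show ?thesis using that by simp
  qed
  then have ev: "\<forall>\<^sub>F z in at 0. z ^ (m - k) * g z = poly Q z"
    unfolding eventually_at using r by (auto intro!: exI[of _ r])
  have "((\<lambda>z. z ^ (m - k) * g z) \<longlongrightarrow> 0 ^ (m - k) * g 0) (at 0)"
    using g by (auto intro!: tendsto_intros simp: isCont_def)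
  then have "(poly Q \<longlongrightarrow> 0) (at 0)"
    using km Lim_transform_eventually[OF _ ev] by (simp add: power_0_left)
  moreover have "(poly Q \<longlongrightarrow> poly Q 0) (at 0)"
    using poly_isCont isCont_def by blast
  ultimately show False
    using \<open>poly Q 0 \<noteq> 0\<close> LIM_unique by blast
qed

text \<open>The primitive as a formal polynomial, so that its coefficients can be compared.\<close>

definition cusp_poly :: "nat \<Rightarrow> (nat \<Rightarrow> complex) \<Rightarrow> complex poly" where
  "cusp_poly n \<alpha> = monom 1 2 + (\<Sum>j=1..n. monom (\<alpha> j) (2 * j + 1))"

lemma poly_cusp_poly: "poly (cusp_poly n \<alpha>) z = cusp_prim n \<alpha> z"
  by (simp add: cusp_poly_def cusp_prim_def poly_sum poly_monom)

text \<open>All exponents in the sum are odd. The case \<open>k = 0\<close> also records that the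
  primitive vanishes at 0.\<close>

lemma coeff_cusp_poly_even: "coeff (cusp_poly n \<alpha>) (2 * k) = (if k = 1 then 1 else 0)"
proof -
  have "2 * j + 1 \<noteq> 2 * k" for j :: nat by presburger
  then show ?thesis by (auto simp: cusp_poly_def coeff_sum)
qed

lemma coeff_cusp_poly_odd:
  assumes "j \<in> {1..n}"
  shows "coeff (cusp_poly n \<alpha>) (2 * j + 1) = \<alpha> j"
proof -
  have "(2::nat) \<noteq> 2 * j + 1" by presburger
  then show ?thesis using assms by (auto simp: cusp_poly_def coeff_sum)
qed

text \<open>Since \<open>u\<close> has constant term 1, the k-th power of the primitive starts with
  exactly \<open>z ^ (2 * k)\<close>.\<close>

lemma cusp_poly_factor: "\<exists>u. cusp_poly n \<alpha> = monom 1 2 * u \<and> coeff u 0 = 1"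
proof (intro exI conjI)
  let ?u = "1 + (\<Sum>j=1..n. monom (\<alpha> j) (2 * j - 1))"
  have "monom (\<alpha> j) (2 * j + 1) = monom 1 2 * monom (\<alpha> j) (2 * j - 1)" if "j \<in> {1..n}" for j
    using that by (simp add: mult_monom)
  then show "cusp_poly n \<alpha> = monom 1 2 * ?u"
    by (simp add: cusp_poly_def distrib_left sum_distrib_left)
  show "coeff ?u 0 = 1" by (auto simp: coeff_sum intro!: sum.neutral)
qed

lemma coeff_pcompose_scale: "coeff (pcompose p [:0, c:]) k = c ^ k * coeff p k"
  for c :: "'a::comm_semiring_1"
  by (induction p arbitrary: k)
    (auto simp: pcompose_pCons coeff_pCons ac_simps split: nat.splits)

lemma pcompose_power: "pcompose (p ^ k) q = pcompose p q ^ k"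
  for p q :: "'a::comm_semiring_1 poly"
  by (induction k) (simp_all add: pcompose_mult pcompose_1)

text \<open>Since only odd exponents above 2 occur in the primitives, the lowest term of
  \<open>p - c\<^sup>2 X\<close> would leave an uncancelled even power of \<open>z\<close> below \<open>2n + 2\<close>.\<close>

lemma cusp_alg_rotated_prim_imp:
  assumes n: "n \<ge> 1" and c: "c \<noteq> 0"
    and mem: "(\<lambda>z. cusp_prim n \<beta> (c * z)) \<in> cusp_alg n \<alpha>"
    and j: "j \<in> {1..n}"
  shows "c ^ (2 * j - 1) * \<beta> j = \<alpha> j"
proof -
  obtain p g where p: "degree p \<le> n" and g: "g holomorphic_on unit_disk"
    and eq: "\<And>z. z \<in> unit_disk \<Longrightarrow>
      cusp_prim n \<beta> (c * z) = poly p (cusp_prim n \<alpha> z) + z ^ (2 * n + 2) * g z"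
    using mem unfolding cusp_alg_def by blast
  \<comment> \<open>Subtracting \<open>c\<^sup>2\<close> times the primitive of
    \<open>\<alpha>\<close> from both sides of \<open>eq\<close> cancels the term in
    \<open>z ^ 2\<close> on the left and turns \<open>p\<close> into \<open>r\<close>.\<close>
  define T where "T = pcompose (cusp_poly n \<beta>) [:0, c:] - smult (c\<^sup>2) (cusp_poly n \<alpha>)"
  define r where "r = p - [:0, c\<^sup>2:]"
  have "isCont g 0"
    using g holomorphic_on_imp_continuous_on continuous_on_eq_continuous_at[of "ball 0 1" g]
    by (auto simp: unit_disk_def)
  then have "monom 1 (2 * n + 2) dvd T - pcompose r (cusp_poly n \<alpha>)"
  proof (rule poly_eq_power_mult_imp_monom_dvd[of _ 1])
    fix z :: complex assume "z \<in> ball 0 1"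
    then show "poly (T - pcompose r (cusp_poly n \<alpha>)) z = z ^ (2 * n + 2) * g z"
      using eq[of z]
      by (simp add: T_def r_def poly_pcompose poly_cusp_poly unit_disk_def algebra_simps)
  qed simp
  then have coeffs: "coeff T k = coeff (pcompose r (cusp_poly n \<alpha>)) k" if "k < 2 * n + 2" for k
    using that unfolding monom_1_dvd_iff' by simp
  have even: "coeff T (2 * k) = 0" for k
    by (simp add: T_def coeff_pcompose_scale coeff_cusp_poly_even)
  have "r = 0"
  proof (rule ccontr)
    assume r: "r \<noteq> 0"
    define k where "k = order 0 r"
    have "degree r \<le> n" using p n unfolding r_def by (intro degree_diff_le) auto
    \<comment> \<open>This keeps \<open>2 * k\<close> below \<open>2 * n + 2\<close>, where the
      remainder cannot interfere.\<close>
    then have k: "k \<le> n" using order_degree[OF r, of 0] by (simp add: k_def)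
    obtain s where s: "r = [:0, 1:] ^ k * s" and ns: "\<not> [:0, 1:] dvd s"
      using order_decomp[OF r, of 0] by (auto simp: k_def)
    have s0: "coeff s 0 \<noteq> 0" using ns by (simp add: dvd_iff_poly_eq_0 poly_0_coeff_0)
    obtain u where u: "cusp_poly n \<alpha> = monom 1 2 * u" and u0: "coeff u 0 = 1"
      using cusp_poly_factor by blast
    \<comment> \<open>With the first factor starting at \<open>z ^ (2 * k)\<close> and the second
      having value s(0) at 0, the coefficient of degree \<open>2 * k\<close> is
      \<open>coeff s 0 \<noteq> 0\<close>, against the vanishing even coefficients of
      \<open>T\<close>.\<close>
    have "pcompose r (cusp_poly n \<alpha>) = cusp_poly n \<alpha> ^ k * pcompose s (cusp_poly n \<alpha>)"
      by (simp add: s pcompose_mult pcompose_power pcompose_pCons)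
    also have "\<dots> = monom 1 (2 * k) * (u ^ k * pcompose s (cusp_poly n \<alpha>))"
      by (simp add: u power_mult_distrib monom_power mult_ac)
    finally have "coeff (pcompose r (cusp_poly n \<alpha>)) (2 * k)
        = coeff (u ^ k * pcompose s (cusp_poly n \<alpha>)) 0"
      by (simp add: coeff_monom_mult)
    also have "\<dots> = coeff s 0"
      using u0 coeff_cusp_poly_even[of n \<alpha> 0]
      by (simp add: poly_pcompose flip: poly_0_coeff_0)
    finally show False using coeffs[of "2 * k"] even k s0 by simp
  qed
  then have "coeff T (2 * j + 1) = 0" using coeffs[of "2 * j + 1"] j by simp
  then have "c ^ (2 * j + 1) * \<beta> j = c\<^sup>2 * \<alpha> j"
    using j by (simp only: T_def coeff_diff coeff_smult coeff_pcompose_scale coeff_cusp_poly_odd) simp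
  moreover have "2 * j + 1 = 2 + (2 * j - 1)" using j by auto
  then have "c ^ (2 * j + 1) = c\<^sup>2 * c ^ (2 * j - 1)"
    by (metis power_add)
  ultimately show ?thesis using c by simp
qed

section \<open>Holizations of cusp algebras\<close>

lemma holizes_cusp_inj_on:
  assumes "holizes h (cusp_alg n \<alpha>)"
  shows "inj_on h unit_disk"
proof (rule inj_onI)
  fix z w assume zw: "z \<in> unit_disk" "w \<in> unit_disk" "h z = h w"
  have "z ^ m = w ^ m" if "m \<ge> 2 * n + 2" for m
  proof -
    have "(\<lambda>z. z ^ m) \<in> A_of h"
      using power_in_cusp_alg[OF that] assms unfolding holizes_def by blast
    then show ?thesis using zw unfolding A_of_def by auto
  qed
  \<comment> \<open>Two consecutive exponents: for \<open>z \<noteq> 0\<close> the lower power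
    cancels from the higher one, and for \<open>z = 0\<close> a power of \<open>w\<close>
    vanishes.\<close>
  from this[of "2 * n + 2"] this[of "Suc (2 * n + 2)"] show "z = w"
    by (cases "z = 0") auto
qed

lemma holizes_coord:
  fixes h :: "complex \<Rightarrow> complex ^ 'n"
  assumes "holizes h A"
  shows "(\<lambda>z. h z $ i) \<in> A"
proof -
  have "(\<lambda>z. h z $ i) \<in> A_of h"
    unfolding A_of_def by (auto intro!: bexI[OF _ O_var_coord[of i]])
  then show ?thesis using assms unfolding holizes_def by simp
qed

text \<open>Away from its zeros \<open>\<sigma>\<close> is the quotient of the two powers.
  Injectivity leaves at most one zero, and it is a removable singularity once
  \<open>\<sigma>\<close> is known to be continuous there.\<close>

lemma holomorphic_on_if_powers:
  fixes \<sigma> :: "complex \<Rightarrow> complex"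
  assumes S: "open S" and inj: "inj_on \<sigma> S" and m: "m > 0"
    and u: "(\<lambda>z. \<sigma> z ^ m) holomorphic_on S" and v: "(\<lambda>z. \<sigma> z ^ Suc m) holomorphic_on S"
  shows "\<sigma> holomorphic_on S"
proof -
  define K where "K = {z \<in> S. \<sigma> z = 0}"
  have "\<exists>a. K \<subseteq> {a}"
    using inj unfolding K_def inj_on_def
    by (metis (mono_tags, lifting) mem_Collect_eq singletonI subsetI)
  then have K: "finite K" using finite_subset by blast
  show ?thesis
  proof (rule no_isolated_singularity'[OF _ _ S K])
    have "(\<lambda>z. \<sigma> z ^ Suc m / \<sigma> z ^ m) holomorphic_on S - K"
      by (intro holomorphic_intros holomorphic_on_subset[OF u] holomorphic_on_subset[OF v])
        (auto simp: K_def)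
    then show "\<sigma> holomorphic_on S - K"
      by (rule holomorphic_transform) (auto simp: K_def)
  next
    fix a assume a: "a \<in> K"
    \<comment> \<open>The real m-th root recovers the modulus of \<open>\<sigma>\<close> from its
      m-th power; at a zero, convergence of the modulus is enough.\<close>
    have "continuous_on S (\<lambda>z. root m (norm (\<sigma> z ^ m)))"
      by (intro continuous_intros holomorphic_on_imp_continuous_on[OF u])
    then have "continuous_on S (\<lambda>z. norm (\<sigma> z))"
      using m by (simp add: norm_power real_root_power_cancel)
    then have "((\<lambda>z. norm (\<sigma> z)) \<longlongrightarrow> 0) (at a within S)"
      using a by (auto simp: continuous_on_def K_def)
    then show "(\<sigma> \<longlongrightarrow> \<sigma> a) (at a within S)"
      using a by (auto simp: K_def tendsto_norm_zero_iff)
  qed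
qed

text \<open>As functions in the cusp algebra have vanishing derivative at \<open>0\<close>, so has
  \<open>\<sigma> ^ (2n + 2)\<close>, which for injective \<open>\<sigma>\<close> forces \<open>\<sigma> 0 = 0\<close>.\<close>

lemma cusp_alg_pullback:
  assumes inj: "inj_on \<sigma> unit_disk"
    and pb: "\<And>f. f \<in> cusp_alg n \<beta> \<Longrightarrow> (\<lambda>z. f (\<sigma> z)) \<in> cusp_alg n \<alpha>"
  shows "\<sigma> holomorphic_on unit_disk" "\<sigma> 0 = 0"
proof -
  have m: "(\<lambda>z. \<sigma> z ^ m) \<in> cusp_alg n \<alpha>" if "m \<ge> 2 * n + 2" for m
    using pb power_in_cusp_alg[OF that] by blast
  show hol: "\<sigma> holomorphic_on unit_disk"
    by (rule holomorphic_on_if_powers[of _ _ "2 * n + 2"])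
      (use inj in \<open>auto simp: unit_disk_def[symmetric] simp del: power_Suc
        intro!: cusp_alg_holomorphic m\<close>, simp add: unit_disk_def)
  have op: "open unit_disk" "0 \<in> unit_disk" by (auto simp: unit_disk_def)
  have "(\<sigma> has_field_derivative deriv \<sigma> 0) (at 0)"
    using hol op holomorphic_derivI by blast
  then have "((\<lambda>z. \<sigma> z ^ (2 * n + 2)) has_field_derivative
      of_nat (2 * n + 2) * \<sigma> 0 ^ (2 * n + 1) * deriv \<sigma> 0) (at 0)"
    using DERIV_power[of \<sigma> "deriv \<sigma> 0" 0 UNIV "2 * n + 2"] by (simp add: mult_ac)
  then have "of_nat (2 * n + 2) * \<sigma> 0 ^ (2 * n + 1) * deriv \<sigma> 0 = 0"
    using cusp_alg_deriv_0[OF m[OF order_refl]] DERIV_imp_deriv by metis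
  moreover have "deriv \<sigma> 0 \<noteq> 0"
    using holomorphic_injective_imp_regular[OF hol op(1) inj op(2)] .
  moreover have "of_nat (2 * n + 2) \<noteq> (0::complex)"
    by (simp only: of_nat_eq_0_iff)
  ultimately show "\<sigma> 0 = 0" by auto
qed

text \<open>The Schwarz lemma for both \<open>\<sigma>\<close> and its left inverse
  \<open>\<rho>\<close> gives |w| = |\<open>\<rho> (\<sigma> w)\<close>| \<le>
  |\<open>\<sigma> w\<close>| \<le> |w|, and equality at one nonzero point makes
  \<open>\<sigma>\<close> a rotation.\<close>

lemma disk_automorphism_fixing_0:
  assumes \<sigma>: "\<sigma> holomorphic_on unit_disk" "\<sigma> 0 = 0" and \<rho>: "\<rho> holomorphic_on unit_disk" "\<rho> 0 = 0"
    and D: "\<And>z. z \<in> unit_disk \<Longrightarrow> \<sigma> z \<in> unit_disk" "\<And>z. z \<in> unit_disk \<Longrightarrow> \<rho> z \<in> unit_disk"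
    and inv: "\<And>z. z \<in> unit_disk \<Longrightarrow> \<rho> (\<sigma> z) = z"
  obtains c where "norm c = 1" "\<And>z. z \<in> unit_disk \<Longrightarrow> \<sigma> z = c * z"
proof -
  have S\<sigma>: "\<And>z. norm z < 1 \<Longrightarrow> norm (\<sigma> z) < 1" and S\<rho>: "\<And>z. norm z < 1 \<Longrightarrow> norm (\<rho> z) < 1"
    using D by (auto simp: unit_disk_def)
  note hol = \<sigma>(1)[unfolded unit_disk_def] \<rho>(1)[unfolded unit_disk_def]
  \<comment> \<open>Any nonzero point of the disk would serve.\<close>
  let ?w = "1/2 :: complex"
  have w: "norm ?w < 1" by simp
  have "norm (\<sigma> ?w) \<le> norm ?w"
    by (rule Schwarz_Lemma(1)[OF hol(1) \<sigma>(2) S\<sigma> w])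
  moreover have "norm (\<rho> (\<sigma> ?w)) \<le> norm (\<sigma> ?w)"
    by (rule Schwarz_Lemma(1)[OF hol(2) \<rho>(2) S\<rho> S\<sigma>[OF w]])
  moreover have "\<rho> (\<sigma> ?w) = ?w"
    by (rule inv) (simp add: unit_disk_def)
  ultimately have "\<exists>z. norm z < 1 \<and> z \<noteq> 0 \<and> norm (\<sigma> z) = norm z"
    by (intro exI[of _ ?w]) auto
  then have "\<exists>c. (\<forall>z. norm z < 1 \<longrightarrow> \<sigma> z = c * z) \<and> norm c = 1"
    using Schwarz_Lemma(3)[OF hol(1) \<sigma>(2) S\<sigma> w] by blast
  then show ?thesis using that by (auto simp: unit_disk_def)
qed

section \<open>From a homeomorphism to a rotation\<close>

lemma bihol_homeo_imp_rotation:
  fixes h\<^sub>\<alpha> :: "complex \<Rightarrow> complex ^ 'n" and h\<^sub>\<beta> :: "complex \<Rightarrow> complex ^ 'm"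
  assumes n: "n \<ge> 1"
    and h: "holizes h\<^sub>\<alpha> (cusp_alg n \<alpha>)" and k: "holizes h\<^sub>\<beta> (cusp_alg n \<beta>)"
    and bi: "bihol_homeo (h\<^sub>\<alpha> ` unit_disk) (h\<^sub>\<beta> ` unit_disk) \<phi> \<psi>"
  shows "\<exists>\<tau>. norm \<tau> = 1 \<and> (\<forall>j\<in>{1..n}. \<beta> j = \<tau> ^ (2 * j - 1) * \<alpha> j)"
proof -
  have hom: "homeomorphism (h\<^sub>\<alpha> ` unit_disk) (h\<^sub>\<beta> ` unit_disk) \<phi> \<psi>"
    and \<phi>: "\<And>j. (\<lambda>x. \<phi> x $ j) \<in> O_var (h\<^sub>\<alpha> ` unit_disk)"
    and \<psi>: "\<And>j. (\<lambda>x. \<psi> x $ j) \<in> O_var (h\<^sub>\<beta> ` unit_disk)"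
    using bi unfolding bihol_homeo_def by auto
  note inj = holizes_cusp_inj_on[OF h] holizes_cusp_inj_on[OF k]
  have Ah: "A_of h\<^sub>\<alpha> = cusp_alg n \<alpha>" and Ak: "A_of h\<^sub>\<beta> = cusp_alg n \<beta>"
    using h k unfolding holizes_def by auto
  \<comment> \<open>The lift exists because \<open>\<phi>\<close> maps into the image of
    \<open>h\<^sub>\<beta>\<close>; injectivity of the holizations then makes the lifts of
    \<open>\<phi>\<close> and \<open>\<psi>\<close> inverse to each other.\<close>
  have "\<forall>z. \<exists>w. z \<in> unit_disk \<longrightarrow> w \<in> unit_disk \<and> h\<^sub>\<beta> w = \<phi> (h\<^sub>\<alpha> z)"
    using homeomorphism_image1[OF hom] by (metis imageE imageI)
  then obtain \<sigma> where \<sigma>: "\<And>z. z \<in> unit_disk \<Longrightarrow> \<sigma> z \<in> unit_disk \<and> h\<^sub>\<beta> (\<sigma> z) = \<phi> (h\<^sub>\<alpha> z)"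
    by metis
  have "\<forall>z. \<exists>w. z \<in> unit_disk \<longrightarrow> w \<in> unit_disk \<and> h\<^sub>\<alpha> w = \<psi> (h\<^sub>\<beta> z)"
    using homeomorphism_image2[OF hom] by (metis imageE imageI)
  then obtain \<rho> where \<rho>: "\<And>z. z \<in> unit_disk \<Longrightarrow> \<rho> z \<in> unit_disk \<and> h\<^sub>\<alpha> (\<rho> z) = \<psi> (h\<^sub>\<beta> z)"
    by metis
  have \<rho>\<sigma>: "\<rho> (\<sigma> z) = z" if "z \<in> unit_disk" for z
    using \<rho>[of "\<sigma> z"] \<sigma>[OF that] that homeomorphism_apply1[OF hom] inj(1)
    by (metis image_eqI inj_onD)
  have \<sigma>\<rho>: "\<sigma> (\<rho> z) = z" if "z \<in> unit_disk" for z
    using \<sigma>[of "\<rho> z"] \<rho>[OF that] that homeomorphism_apply2[OF hom] inj(2)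
    by (metis image_eqI inj_onD)
  have pb\<sigma>: "(\<lambda>z. f (\<sigma> z)) \<in> cusp_alg n \<alpha>" if "f \<in> cusp_alg n \<beta>" for f
    using A_of_pullback[where k = h\<^sub>\<beta> and \<sigma> = \<sigma>, OF \<phi> \<sigma>] that unfolding Ah Ak by blast
  have pb\<rho>: "(\<lambda>z. f (\<rho> z)) \<in> cusp_alg n \<beta>" if "f \<in> cusp_alg n \<alpha>" for f
    using A_of_pullback[where k = h\<^sub>\<alpha> and \<sigma> = \<rho>, OF \<psi> \<rho>] that unfolding Ah Ak by blast
  have "inj_on \<sigma> unit_disk" "inj_on \<rho> unit_disk"
    using \<rho>\<sigma> \<sigma>\<rho> by (metis inj_on_inverseI)+
  then have "\<sigma> holomorphic_on unit_disk" "\<sigma> 0 = 0" "\<rho> holomorphic_on unit_disk" "\<rho> 0 = 0"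
    using cusp_alg_pullback pb\<sigma> pb\<rho> by blast+
  then obtain c where c: "norm c = 1" and \<sigma>c: "\<And>z. z \<in> unit_disk \<Longrightarrow> \<sigma> z = c * z"
    using disk_automorphism_fixing_0[of \<sigma> \<rho>] \<sigma> \<rho> \<rho>\<sigma> by metis
  have "c \<noteq> 0" using c by auto
  \<comment> \<open>The pullback is applied to the primitive of \<open>\<beta>\<close> itself;
    replacing \<open>\<sigma> z\<close> by \<open>c * z\<close> on the disk preserves
    membership.\<close>
  have "(\<lambda>z. cusp_prim n \<beta> (c * z)) \<in> cusp_alg n \<alpha>"
    using pb\<sigma>[OF cusp_prim_in_cusp_alg[OF n]] \<sigma>c unfolding cusp_alg_def by auto
  then have "c ^ (2 * j - 1) * \<beta> j = \<alpha> j" if "j \<in> {1..n}" for j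
    using cusp_alg_rotated_prim_imp[OF n \<open>c \<noteq> 0\<close>] that by blast
  then have "\<forall>j\<in>{1..n}. \<beta> j = inverse c ^ (2 * j - 1) * \<alpha> j"
    using \<open>c \<noteq> 0\<close> by (auto simp: field_simps)
  then show ?thesis
    using c by (intro exI[of _ "inverse c"]) (simp add: norm_inverse)
qed

section \<open>From a rotation to a homeomorphism\<close>

lemma rotation_imp_O_var_map:
  fixes h\<^sub>\<alpha> :: "complex \<Rightarrow> complex ^ 'n" and h\<^sub>\<beta> :: "complex \<Rightarrow> complex ^ 'm"
  assumes h: "holizes h\<^sub>\<alpha> (cusp_alg n \<alpha>)" and k: "holizes h\<^sub>\<beta> (cusp_alg n \<beta>)"
    and \<tau>: "norm \<tau> = 1" and \<alpha>: "\<forall>j\<in>{1..n}. \<alpha> j = \<tau> ^ (2 * j - 1) * \<beta> j"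
    and \<phi>: "\<And>z. z \<in> unit_disk \<Longrightarrow> \<phi> (h\<^sub>\<alpha> z) = h\<^sub>\<beta> (\<tau> * z)"
  shows "(\<lambda>x. \<phi> x $ j) \<in> O_var (h\<^sub>\<alpha> ` unit_disk)"
proof -
  \<comment> \<open>A coordinate of \<open>h\<^sub>\<beta>\<close> lies in the algebra of
    \<open>\<beta>\<close>, so its rotation lies in that of \<open>\<alpha>\<close> and hence
    factors through \<open>h\<^sub>\<alpha>\<close>. The factor agrees with the coordinate of
    \<open>\<phi>\<close> on the variety.\<close>
  have "(\<lambda>z. h\<^sub>\<beta> (\<tau> * z) $ j) \<in> cusp_alg n \<alpha>"
    by (rule cusp_alg_rotate[OF \<tau> \<alpha> holizes_coord[OF k]])
  then have "(\<lambda>z. h\<^sub>\<beta> (\<tau> * z) $ j) \<in> A_of h\<^sub>\<alpha>"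
    using h unfolding holizes_def by simp
  then obtain F where F: "F \<in> O_var (h\<^sub>\<alpha> ` unit_disk)"
    and eq: "\<And>z. z \<in> unit_disk \<Longrightarrow> h\<^sub>\<beta> (\<tau> * z) $ j = F (h\<^sub>\<alpha> z)"
    unfolding A_of_def by blast
  show ?thesis
    by (rule O_var_cong[OF F]) (use eq \<phi> in auto)
qed

lemma rotation_imp_bihol_homeo:
  fixes h\<^sub>\<alpha> :: "complex \<Rightarrow> complex ^ 'n" and h\<^sub>\<beta> :: "complex \<Rightarrow> complex ^ 'm"
  assumes h: "holizes h\<^sub>\<alpha> (cusp_alg n \<alpha>)" and k: "holizes h\<^sub>\<beta> (cusp_alg n \<beta>)"
    and \<tau>: "norm \<tau> = 1" and \<beta>: "\<forall>j\<in>{1..n}. \<beta> j = \<tau> ^ (2 * j - 1) * \<alpha> j"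
  shows "\<exists>\<phi> \<psi>. bihol_homeo (h\<^sub>\<alpha> ` unit_disk) (h\<^sub>\<beta> ` unit_disk) \<phi> \<psi>"
proof -
  note inj = holizes_cusp_inj_on[OF h] holizes_cusp_inj_on[OF k]
  \<comment> \<open>Rotation by \<open>\<tau>\<close> carries the algebra of \<open>\<alpha>\<close>
    into that of \<open>\<beta>\<close>, so \<open>\<tau>\<close> belongs to the map into the
    variety of \<open>\<alpha>\<close>, namely \<open>\<psi>\<close>, and its inverse to
    \<open>\<phi>\<close>.\<close>
  define \<phi> where "\<phi> x = h\<^sub>\<beta> (inverse \<tau> * the_inv_into unit_disk h\<^sub>\<alpha> x)" for x
  define \<psi> where "\<psi> y = h\<^sub>\<alpha> (\<tau> * the_inv_into unit_disk h\<^sub>\<beta> y)" for y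
  have \<phi>: "\<phi> (h\<^sub>\<alpha> z) = h\<^sub>\<beta> (inverse \<tau> * z)" if "z \<in> unit_disk" for z
    using that inj by (simp add: \<phi>_def the_inv_into_f_f)
  have \<psi>: "\<psi> (h\<^sub>\<beta> z) = h\<^sub>\<alpha> (\<tau> * z)" if "z \<in> unit_disk" for z
    using that inj by (simp add: \<psi>_def the_inv_into_f_f)
  have \<tau>0: "\<tau> \<noteq> 0" and \<tau>': "norm (inverse \<tau>) = 1" using \<tau> by (auto simp: norm_inverse)
  have D: "\<tau> * z \<in> unit_disk" "inverse \<tau> * z \<in> unit_disk" if "z \<in> unit_disk" for z
    using that \<tau> \<tau>' by (auto simp: unit_disk_def norm_mult)
  have \<alpha>: "\<forall>j\<in>{1..n}. \<alpha> j = inverse \<tau> ^ (2 * j - 1) * \<beta> j"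
    using \<beta> \<tau>0 by (auto simp: field_simps)
  have O\<phi>: "(\<lambda>x. \<phi> x $ j) \<in> O_var (h\<^sub>\<alpha> ` unit_disk)" for j
    using rotation_imp_O_var_map[OF h k \<tau>' \<alpha> \<phi>] .
  have O\<psi>: "(\<lambda>y. \<psi> y $ j) \<in> O_var (h\<^sub>\<beta> ` unit_disk)" for j
    using rotation_imp_O_var_map[OF k h \<tau> \<beta> \<psi>] .
  have "homeomorphism (h\<^sub>\<alpha> ` unit_disk) (h\<^sub>\<beta> ` unit_disk) \<phi> \<psi>"
  proof (rule homeomorphismI)
    show "continuous_on (h\<^sub>\<alpha> ` unit_disk) \<phi>"
      using continuous_on_vec_lambda[of _ "\<lambda>j x. \<phi> x $ j"]
        O_var_imp_continuous_on[OF O\<phi>] by simp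
    show "continuous_on (h\<^sub>\<beta> ` unit_disk) \<psi>"
      using continuous_on_vec_lambda[of _ "\<lambda>j x. \<psi> x $ j"]
        O_var_imp_continuous_on[OF O\<psi>] by simp
  qed (use \<phi> \<psi> D \<tau>0 in \<open>auto simp: mult.assoc[symmetric]\<close>)
  then show ?thesis
    using O\<phi> O\<psi> unfolding bihol_homeo_def by blast
qed

theorem theorem4p5:
  fixes n :: nat and \<alpha> \<beta> :: "nat \<Rightarrow> complex"
    and h\<^sub>\<alpha> :: "complex \<Rightarrow> complex ^ 'n" and h\<^sub>\<beta> :: "complex \<Rightarrow> complex ^ 'm"
  assumes "n \<ge> 1"
    and "holizes h\<^sub>\<alpha> (cusp_alg n \<alpha>)"
    and "holizes h\<^sub>\<beta> (cusp_alg n \<beta>)"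
  shows "(\<exists>\<phi> \<psi>. bihol_homeo (h\<^sub>\<alpha> ` unit_disk) (h\<^sub>\<beta> ` unit_disk) \<phi> \<psi>) \<longleftrightarrow>
         (\<exists>\<tau>::complex. norm \<tau> = 1 \<and> (\<forall>j\<in>{1..n}. \<beta> j = \<tau> ^ (2 * j - 1) * \<alpha> j))"
  using bihol_homeo_imp_rotation[OF assms] rotation_imp_bihol_homeo[OF assms(2,3)] by blast

end
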